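(* For every integer $m\ge 0$ and every $z\in\mathbb{C}$, $$\lim_{N\to\infty}\left(\frac{4}{N}\right)^{m/2}E_m^N\!\left(\frac{\sqrt N}{2}z+\frac N2\right)=H_m(z),$$ where $N$ runs over the positive integers, $E_m^N$ is the generalized Euler polynomial of degree $m$ and order $N$, and $H_m$ is the Hermite polynomial.
   Context: The generalized Euler polynomials of order $N$ are defined by $\dfrac{2^N e^{\omega z}}{(e^\omega+1)^N}=\sum_{m=0}^\infty \dfrac{E_m^N(z)}{m!}\omega^m$ for $|\omega|<\pi$. The Hermite polynomials $H_m$ are normalized by $e^{xz-z^2/2}=\sum_{m\ge 0}\frac{H_m(x)}{m!}z^m$. *)

theory Defs
  imports "HOL-Complex_Analysis.Complex_Analysis"
begin

definition gen_euler :: "nat \<Rightarrow> nat \<Rightarrow> complex \<Rightarrow> complex" where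
  "gen_euler N m z =
     (THE E. \<forall>\<omega>. norm \<omega> < pi \<longrightarrow>
        (\<lambda>k. E k / fact k * \<omega> ^ k) sums (2 ^ N * exp (\<omega> * z) / (exp \<omega> + 1) ^ N)) m"

text \<open>
  This is the probabilists' normalization, matching the exponential generating function
  \<open>exp (x t - t\<^sup>2 / 2)\<close>.
\<close>

definition hermite :: "nat \<Rightarrow> complex \<Rightarrow> complex" where
  "hermite m x =
     (THE H. \<forall>t. (\<lambda>k. H k / fact k * t ^ k) sums exp (x * t - t\<^sup>2 / 2)) m"

text \<open>
  The descriptions above are proper: each generating function has exactly one
  sequence of coefficients.
\<close>

lemma egf_coeffs_unique:
  fixes E :: "nat \<Rightarrow> complex"
  assumes r: "r > 0"
    and s: "\<And>w. norm w < r \<Longrightarrow> (\<lambda>k. E k / fact k * w ^ k) sums f w"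
  shows "E = (\<lambda>k. (deriv ^^ k) f 0)"
proof
  fix k
  define F where "F = Abs_fps (\<lambda>k. E k / fact k)"
  have conv: "fps_conv_radius F \<ge> ereal r"
    unfolding fps_conv_radius_def
    by (rule conv_radius_geI_ex') (use s in \<open>fastforce simp: F_def sums_iff\<close>)
  have "eventually (\<lambda>w. w \<in> ball 0 r) (nhds (0::complex))"
    using r by (intro eventually_nhds_in_open) auto
  hence ev: "eventually (\<lambda>w. eval_fps F w = f w) (nhds 0)"
    by eventually_elim (use s in \<open>auto simp: eval_fps_def F_def sums_iff\<close>)
  have "fps_conv_radius F > 0"
    using conv r by (metis ereal_less(2) less_le_trans)
  with ev have "f has_fps_expansion F"
    by (auto simp: has_fps_expansion_def)
  hence "fps_nth F k = (deriv ^^ k) f 0 / fact k"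
    by (rule fps_nth_fps_expansion)
  thus "E k = (deriv ^^ k) f 0"
    by (simp add: F_def)
qed

lemma exp_plus_one_nonzero:
  assumes "norm (w::complex) < pi"
  shows "exp w + 1 \<noteq> 0"
proof
  assume "exp w + 1 = 0"
  hence "exp w = exp (\<i> * pi)"
    by (simp add: eq_neg_iff_add_eq_0)
  then obtain n :: int where "w = \<i> * pi + of_int (2 * n) * pi * \<i>"
    using exp_eq by blast
  hence "w = of_real (of_int (2 * n + 1) * pi) * \<i>"
    by (simp add: algebra_simps)
  hence "norm w = \<bar>of_int (2 * n + 1)\<bar> * pi"
    by (simp only: norm_mult norm_ii norm_of_real abs_mult) simp
  moreover have "\<bar>of_int (2 * n + 1)\<bar> \<ge> (1::real)"
  proof -
    have "\<bar>2 * n + 1\<bar> \<ge> 1"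
      by presburger
    thus ?thesis
      by (metis of_int_1_le_iff of_int_abs)
  qed
  ultimately show False
    using assms mult_right_mono[of 1 "\<bar>of_int (2 * n + 1)\<bar>" pi] by simp
qed

lemma gen_euler_sums:
  assumes "norm \<omega> < pi"
  shows "(\<lambda>m. gen_euler N m z / fact m * \<omega> ^ m) sums
           (2 ^ N * exp (\<omega> * z) / (exp \<omega> + 1) ^ N)"
proof -
  define f where "f = (\<lambda>w::complex. 2 ^ N * exp (w * z) / (exp w + 1) ^ N)"
  define P where "P = (\<lambda>E::nat \<Rightarrow> complex. \<forall>w. norm w < pi \<longrightarrow>
                        (\<lambda>k. E k / fact k * w ^ k) sums f w)"
  have "f holomorphic_on ball 0 pi"
    unfolding f_def by (intro holomorphic_intros) (auto simp: exp_plus_one_nonzero)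
  hence ex: "P (\<lambda>k. (deriv ^^ k) f 0)"
    using holomorphic_power_series[of f 0 pi] by (auto simp: P_def)
  have "E = (\<lambda>k. (deriv ^^ k) f 0)" if "P E" for E
    using that by (intro egf_coeffs_unique[of pi]) (auto simp: P_def)
  with ex have "P (The P)"
    by (rule theI)
  moreover have "gen_euler N m z = The P m" for m
    by (simp add: gen_euler_def P_def f_def)
  ultimately show ?thesis
    using assms by (simp add: P_def f_def)
qed

lemma hermite_sums: "(\<lambda>m. hermite m x / fact m * t ^ m) sums exp (x * t - t\<^sup>2 / 2)"
proof -
  define f where "f = (\<lambda>t. exp (x * t - t\<^sup>2 / 2))"
  define P where "P = (\<lambda>H::nat \<Rightarrow> complex. \<forall>t. (\<lambda>k. H k / fact k * t ^ k) sums f t)"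
  have hol: "f holomorphic_on ball 0 r" for r
    unfolding f_def by (intro holomorphic_intros) auto
  have ex: "P (\<lambda>k. (deriv ^^ k) f 0)"
    unfolding P_def
  proof
    fix t
    show "(\<lambda>k. (deriv ^^ k) f 0 / fact k * t ^ k) sums f t"
      using holomorphic_power_series[OF hol[of "norm t + 1"], of t] by simp
  qed
  have "H = (\<lambda>k. (deriv ^^ k) f 0)" if "P H" for H
    using that by (intro egf_coeffs_unique[of 1]) (auto simp: P_def)
  with ex have "P (The P)"
    by (rule theI)
  moreover have "hermite m x = The P m" for m
    by (simp add: hermite_def P_def f_def)
  ultimately show ?thesis
    by (simp add: P_def f_def)
qed

end

theory Submission imports Defs begin

text \<open>
  Substituting \<open>\<omega> = 2 * w / sqrt N\<close> in the generating function of the generalized Euler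
  polynomials, at the point \<open>sqrt N / 2 * z + N / 2\<close>, turns it into
  \<open>exp (w * z) / cosh (w / sqrt N) ^ N\<close>: the shift by \<open>N / 2\<close> is exactly what makes the
  denominator symmetric. The coefficients of this function of \<open>w\<close> are the rescaled values
  whose limit is sought. By the central limit scaling \<open>cosh (w / sqrt N) ^ N\<close> tends
  to \<open>exp (w\<^sup>2 / 2)\<close>, so the generating functions tend to \<open>exp (w * z - w\<^sup>2 / 2)\<close>, which
  generates the Hermite polynomials. Coefficients are derivatives at \<open>0\<close>, and these converge
  because the convergence of the generating functions is uniform on the unit disc.

  Uniformity comes from comparing power series. The coefficients of \<open>cosh u\<close> are
  dominated by those of \<open>exp (u\<^sup>2 / 2)\<close>, so that the norm of the difference of the two functions
  at \<open>u\<close> is at most their difference at the real point \<open>norm u\<close>, which is of fourth order.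
  With \<open>u = w / sqrt N\<close> the two functions differ by at most \<open>1 / (4 * N\<^sup>2)\<close> on the unit disc,
  and taking \<open>N\<close>-th powers costs only a factor of order \<open>N\<close>.
\<close>

section \<open>Comparison of the power series of cosh and of the Gaussian\<close>

lemma sums_cosh_even:
  fixes x :: "'a :: {banach, real_normed_field}"
  shows "(\<lambda>n. x ^ (2 * n) / fact (2 * n)) sums cosh x"
proof -
  have "(\<lambda>n. if even n then x ^ n /\<^sub>R fact n else 0) sums cosh x"
    by (rule cosh_converges)
  also have "?this \<longleftrightarrow> (\<lambda>n. if even (2 * n) then x ^ (2 * n) /\<^sub>R fact (2 * n) else 0) sums cosh x"
    by (rule sums_mono_reindex [symmetric]) (auto simp: strict_mono_def elim!: evenE)
  finally show ?thesis
    by (simp add: scaleR_conv_of_real field_simps)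
qed

lemma sums_exp_half_square:
  fixes x :: "'a :: {banach, real_normed_field}"
  shows "(\<lambda>n. x ^ (2 * n) / (2 ^ n * fact n)) sums exp (x\<^sup>2 / 2)"
  using exp_converges[of "x\<^sup>2 / 2"]
  by (simp add: scaleR_conv_of_real power_divide field_simps flip: power_mult)

lemma two_power_fact_le_fact_double: "2 ^ n * fact n \<le> (fact (2 * n) :: real)"
proof (induction n)
  case (Suc n)
  have "2 ^ Suc n * fact (Suc n) = (2 * real n + 2) * (2 ^ n * fact n)"
    by (simp add: algebra_simps)
  also have "\<dots> \<le> (2 * real n + 2) * ((2 * real n + 1) * fact (2 * n))"
  proof (intro mult_left_mono)
    have "1 * fact (2 * n) \<le> (2 * real n + 1) * fact (2 * n)"
      by (intro mult_right_mono) auto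
    with Suc.IH show "2 ^ n * fact n \<le> (2 * real n + 1) * fact (2 * n)"
      by linarith
  qed auto
  also have "\<dots> = fact (2 * Suc n)"
    by (simp add: algebra_simps)
  finally show ?case .
qed simp

text \<open>
  The power series of \<open>exp (u\<^sup>2 / 2) - cosh u\<close> has nonnegative coefficients, because
  \<open>2 ^ n * fact n \<le> fact (2 * n)\<close>; such a function is bounded in norm by its value at \<open>norm u\<close>.
\<close>

lemma norm_exp_half_square_minus_cosh_le:
  fixes u :: complex
  shows "norm (exp (u\<^sup>2 / 2) - cosh u) \<le> exp ((norm u)\<^sup>2 / 2) - cosh (norm u)"
proof (rule norm_sums_le)
  show "(\<lambda>n. u ^ (2 * n) / (2 ^ n * fact n) - u ^ (2 * n) / fact (2 * n))
          sums (exp (u\<^sup>2 / 2) - cosh u)"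
    by (intro sums_diff sums_exp_half_square sums_cosh_even)
  show "(\<lambda>n. norm u ^ (2 * n) / (2 ^ n * fact n) - norm u ^ (2 * n) / fact (2 * n))
          sums (exp ((norm u)\<^sup>2 / 2) - cosh (norm u))"
    by (intro sums_diff sums_exp_half_square sums_cosh_even)
  fix n
  define c :: real where "c = 1 / (2 ^ n * fact n) - 1 / fact (2 * n)"
  have "c \<ge> 0"
    unfolding c_def using two_power_fact_le_fact_double[of n]
    by (simp add: frac_le)
  have "u ^ (2 * n) / (2 ^ n * fact n) - u ^ (2 * n) / fact (2 * n) = u ^ (2 * n) * of_real c"
    by (simp add: c_def algebra_simps)
  also have "norm \<dots> = norm u ^ (2 * n) * c"
    using \<open>c \<ge> 0\<close> by (simp add: norm_mult norm_power)
  also have "\<dots> = norm u ^ (2 * n) / (2 ^ n * fact n) - norm u ^ (2 * n) / fact (2 * n)"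
    by (simp add: c_def algebra_simps)
  finally show "norm (u ^ (2 * n) / (2 ^ n * fact n) - u ^ (2 * n) / fact (2 * n))
      \<le> norm u ^ (2 * n) / (2 ^ n * fact n) - norm u ^ (2 * n) / fact (2 * n)"
    by simp
qed

lemma norm_cosh_le_exp_half_square:
  fixes u :: complex
  shows "norm (cosh u) \<le> exp ((norm u)\<^sup>2 / 2)"
proof (rule norm_sums_le[OF sums_cosh_even sums_exp_half_square])
  show "norm (u ^ (2 * n) / fact (2 * n)) \<le> norm u ^ (2 * n) / (2 ^ n * fact n)" for n
    using two_power_fact_le_fact_double[of n]
    by (simp add: norm_divide norm_power frac_le)
qed

text \<open>
  The majorization reduces this to a real variable, where the two functions agree up to the
  quadratic term.
\<close>

lemma norm_exp_half_square_minus_cosh_le_power4: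
  fixes u :: complex
  assumes "norm u \<le> 1"
  shows "norm (exp (u\<^sup>2 / 2) - cosh u) \<le> norm u ^ 4 / 4"
proof -
  define r where "r = norm u"
  have r: "0 \<le> r" "r \<le> 1"
    using assms by (auto simp: r_def)
  have "r\<^sup>2 \<le> 1"
    using r by (simp add: power_le_one)
  hence "exp (r\<^sup>2 / 2) \<le> 1 + r\<^sup>2 / 2 + (r\<^sup>2 / 2)\<^sup>2"
    by (intro exp_bound) auto
  moreover have "1 + r\<^sup>2 / 2 \<le> cosh r"
  proof -
    have "(\<Sum>n<2. r ^ (2 * n) / fact (2 * n)) \<le> (\<Sum>n. r ^ (2 * n) / fact (2 * n))"
      by (rule sum_le_suminf) (use r sums_cosh_even[of r] in \<open>auto simp: sums_iff\<close>)
    also have "\<dots> = cosh r"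
      using sums_cosh_even[of r] by (simp add: sums_iff)
    finally have "(\<Sum>n<2. r ^ (2 * n) / fact (2 * n)) \<le> cosh r" .
    thus ?thesis
      by (simp add: numeral_2_eq_2)
  qed
  ultimately have "exp (r\<^sup>2 / 2) - cosh r \<le> r ^ 4 / 4"
    by (simp add: power_divide flip: power_mult)
  thus ?thesis
    using norm_exp_half_square_minus_cosh_le[of u] by (simp add: r_def)
qed

section \<open>Uniform convergence of powers of cosh\<close>

text \<open>
  In the application \<open>B\<close> is \<open>1 + O(1 / n)\<close>, so that \<open>B ^ n\<close> stays bounded and a difference of
  order \<open>1 / n\<^sup>2\<close> between the bases leaves one of order \<open>1 / n\<close> between the powers.
\<close>

lemma norm_power_diff_le:
  fixes x y :: "'a :: real_normed_field"
  assumes "norm x \<le> B" "norm y \<le> B" "B \<ge> 1"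
  shows "norm (x ^ n - y ^ n) \<le> real n * B ^ n * norm (x - y)"
proof -
  have B: "B > 0"
    using assms by simp
  have "norm ((x / of_real B) ^ n - (y / of_real B) ^ n)
          \<le> real n * norm (x / of_real B - y / of_real B)"
    by (rule norm_power_diff) (use assms B in \<open>auto simp: norm_divide\<close>)
  also have "\<dots> = real n * norm (x - y) / B"
    using B by (simp add: norm_divide flip: diff_divide_distrib)
  also have "\<dots> \<le> real n * norm (x - y)"
    using mult_left_mono[of 1 B "real n * norm (x - y)"] assms B by (simp add: divide_le_eq)
  finally show ?thesis
    using B by (simp add: power_divide norm_divide norm_power divide_le_eq mult_ac
                     flip: diff_divide_distrib)
qed

text \<open>
  Both \<open>cosh (w / sqrt N)\<close> and \<open>exp (w\<^sup>2 / (2 * N))\<close> are bounded by \<open>exp (1 / (2 * N))\<close> on the unit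
  disc, and the \<open>N\<close>-th power of this bound is \<open>exp (1 / 2)\<close>.
\<close>

lemma norm_cosh_power_minus_exp_le:
  fixes w :: complex
  assumes "norm w \<le> 1" "N > 0"
  shows "norm (cosh (w / of_real (sqrt (real N))) ^ N - exp (w\<^sup>2 / 2)) \<le> exp (1 / 2) / (4 * real N)"
proof -
  define u where "u = w / of_real (sqrt (real N))"
  define B where "B = exp (1 / (2 * real N))"
  have u2: "u\<^sup>2 = w\<^sup>2 / of_nat N"
    using assms by (simp add: u_def power_divide flip: of_real_power)
  have "(norm u)\<^sup>2 = (norm w)\<^sup>2 / real N"
    using assms by (simp add: u_def norm_divide power_divide)
  hence nu: "(norm u)\<^sup>2 \<le> 1 / real N"
    using assms by (simp add: divide_right_mono power_le_one)
  have "1 / real N \<le> 1"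
    using assms by simp
  with nu have "(norm u)\<^sup>2 \<le> 1"
    by linarith
  hence nu1: "norm u \<le> 1"
    by (simp add: power_le_one_iff)
  have expB: "exp ((norm u)\<^sup>2 / 2) \<le> B"
    using nu by (simp add: B_def)
  have 1: "norm (cosh u) \<le> B"
    using norm_cosh_le_exp_half_square[of u] expB by linarith
  have "norm (exp (u\<^sup>2 / 2)) \<le> exp (norm (u\<^sup>2 / 2))"
    by (rule norm_exp)
  also have "\<dots> \<le> B"
    using expB by (simp add: norm_divide norm_power)
  finally have 2: "norm (exp (u\<^sup>2 / 2)) \<le> B" .
  have "B ^ N = exp (1 / 2)"
    using assms by (simp add: B_def flip: exp_of_nat_mult)
  moreover have "exp (u\<^sup>2 / 2) ^ N = exp (w\<^sup>2 / 2)"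
    using assms by (simp add: u2 flip: exp_of_nat_mult)
  moreover have "norm (cosh u ^ N - exp (u\<^sup>2 / 2) ^ N)
      \<le> real N * B ^ N * norm (cosh u - exp (u\<^sup>2 / 2))"
    using 1 2 by (rule norm_power_diff_le) (simp add: B_def)
  ultimately have "norm (cosh u ^ N - exp (w\<^sup>2 / 2))
      \<le> real N * exp (1 / 2) * norm (cosh u - exp (u\<^sup>2 / 2))"
    by simp
  also have "norm (cosh u - exp (u\<^sup>2 / 2)) \<le> ((norm u)\<^sup>2)\<^sup>2 / 4"
    using norm_exp_half_square_minus_cosh_le_power4[OF nu1]
    by (simp add: norm_minus_commute flip: power_mult)
  also have "((norm u)\<^sup>2)\<^sup>2 \<le> (1 / real N)\<^sup>2"
    using nu by (intro power_mono) auto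
  finally show ?thesis
    using assms by (simp add: u_def power2_eq_square field_simps)
qed

lemma uniform_limit_cosh_power:
  "uniform_limit (cball 0 1) (\<lambda>N w. cosh (w / complex_of_real (sqrt (real N))) ^ N)
     (\<lambda>w. exp (w\<^sup>2 / 2)) sequentially"
proof (rule uniform_limitI)
  fix e :: real
  assume "e > 0"
  have "(\<lambda>N. exp (1 / 2) / (4 * real N)) \<longlonglongrightarrow> 0"
    by real_asymp
  hence "eventually (\<lambda>N. exp (1 / 2) / (4 * real N) < e) sequentially"
    using \<open>e > 0\<close> by (rule order_tendstoD)
  with eventually_gt_at_top[of 0]
  show "\<forall>\<^sub>F N in sequentially. \<forall>w\<in>cball 0 1.
          dist (cosh (w / complex_of_real (sqrt (real N))) ^ N) (exp (w\<^sup>2 / 2)) < e"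
  proof eventually_elim
    case (elim N)
    thus ?case
      using norm_cosh_power_minus_exp_le[of _ N] by (fastforce simp: dist_norm)
  qed
qed

section \<open>The rescaled generating function\<close>

lemma exp_plus_one_eq_cosh: "exp (2 * v) + 1 = 2 * exp v * cosh (v :: complex)"
proof -
  have "exp v * exp (- v) = 1"
    by (simp flip: exp_add)
  thus ?thesis
    by (simp add: cosh_field_def exp_double power2_eq_square distrib_left)
qed

lemma cosh_nonzero:
  assumes "norm (v :: complex) \<le> 1"
  shows "cosh v \<noteq> 0"
proof -
  have "norm (2 * v) < pi"
    using assms pi_gt3 by (simp add: norm_mult)
  from exp_plus_one_nonzero[OF this] show ?thesis
    by (simp add: exp_plus_one_eq_cosh)
qed

text \<open>
  The change of variables \<open>\<omega> = 2 * w / sqrt N\<close> stays inside the disc of convergence, since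
  \<open>norm \<omega> \<le> 2 < pi\<close>. The factor \<open>exp (N * w / sqrt N)\<close> that comes from the shift by \<open>N / 2\<close> cancels
  against the same factor in \<open>(exp \<omega> + 1) ^ N\<close>.
\<close>

lemma rescaled_gen_euler_sums:
  assumes "norm w \<le> 1" "N > 0"
  shows "(\<lambda>k. complex_of_real ((4 / real N) powr (real k / 2)) *
              gen_euler N k (complex_of_real (sqrt (real N) / 2) * z + of_nat N / 2)
              / fact k * w ^ k)
           sums (exp (w * z) / cosh (w / of_real (sqrt (real N))) ^ N)"
proof -
  define s where "s = sqrt (real N)"
  define v where "v = w / of_real s"
  define x where "x = complex_of_real (s / 2) * z + of_nat N / 2"
  have s: "s > 0" "s \<ge> 1" "s\<^sup>2 = real N"
    using assms by (auto simp: s_def)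
  have sN: "complex_of_real s * complex_of_real s = of_nat N"
    using s(3) by (metis of_real_mult of_real_of_nat_eq power2_eq_square)
  have "norm v \<le> 1"
    using assms s by (simp add: v_def norm_divide divide_le_eq)
  hence pi: "norm (2 * v) < pi"
    using pi_gt3 by (simp add: norm_mult)
  have "(4 / real N) powr (real k / 2) = (2 / s) ^ k" for k
  proof -
    have "4 / real N = (2 / s) powr 2"
      using s by (simp add: power_divide)
    hence "(4 / real N) powr (real k / 2) = ((2 / s) powr 2) powr (real k / 2)"
      by (rule arg_cong)
    also have "\<dots> = (2 / s) ^ k"
      using s by (simp only: powr_powr) (simp add: powr_realpow)
    finally show ?thesis .
  qed
  hence coeff: "complex_of_real ((4 / real N) powr (real k / 2)) * gen_euler N k x / fact k * w ^ k
      = gen_euler N k x / fact k * (2 * v) ^ k" for k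
    by (simp add: v_def power_mult_distrib power_divide mult_ac)
  have w: "w = v * of_real s"
    using s by (simp add: v_def)
  have "2 * v * x = w * z + of_nat N * v"
    unfolding w x_def sN [symmetric] by (simp add: algebra_simps)
  hence "2 ^ N * exp (2 * v * x) / (exp (2 * v) + 1) ^ N
      = 2 ^ N * (exp (w * z) * exp v ^ N) / (2 * exp v * cosh v) ^ N"
    by (simp add: exp_plus_one_eq_cosh exp_add exp_of_nat_mult)
  also have "\<dots> = exp (w * z) / cosh v ^ N"
    by (simp add: power_mult_distrib)
  finally show ?thesis
    using gen_euler_sums[OF pi, of N x] by (simp only: coeff flip: x_def v_def s_def)
qed

section \<open>Convergence to the Hermite polynomials\<close>

theorem corollary3p2:
  fixes m :: nat and z :: complex
  shows "(\<lambda>N::nat. complex_of_real ((4 / real N) powr (real m / 2)) *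
            gen_euler N m (complex_of_real (sqrt (real N) / 2) * z + of_nat N / 2))
         \<longlonglongrightarrow> hermite m z"
proof -
  define f where "f = (\<lambda>N w. exp (w * z) / cosh (w / complex_of_real (sqrt (real N))) ^ N)"
  define g where "g = (\<lambda>w. exp (w * z) / exp (w\<^sup>2 / 2))"
  \<comment> \<open>The limit of the denominators is bounded away from zero on the disc, so quotients converge
     uniformly as well.\<close>
  have "uniform_limit (cball 0 1) f g sequentially"
    unfolding f_def g_def
  proof (rule uniform_lim_divide[OF uniform_limit_const uniform_limit_cosh_power])
    show "bounded ((\<lambda>w. exp (w * z)) ` cball 0 1)"
      by (intro compact_imp_bounded compact_continuous_image continuous_intros) auto
    show "exp (- (1 / 2)) \<le> norm (exp (w\<^sup>2 / 2))" if "w \<in> cball 0 1" for w :: complex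
    proof -
      have "norm (w\<^sup>2) \<le> 1"
        using that by (simp add: norm_power power_le_one)
      hence "- (1 / 2) \<le> Re (w\<^sup>2 / 2)"
        using abs_Re_le_cmod[of "w\<^sup>2"] by simp
      thus ?thesis
        by (simp only: norm_exp_eq_Re exp_le_cancel_iff)
    qed
  qed simp
  hence "uniform_limit (ball 0 1) f g sequentially"
    by (rule uniform_limit_on_subset) auto
  moreover have "eventually (\<lambda>N. f N holomorphic_on ball 0 1) sequentially"
    using eventually_gt_at_top[of 0]
  proof eventually_elim
    case (elim N)
    have "cosh (w / complex_of_real (sqrt (real N))) \<noteq> 0" if "w \<in> ball 0 1" for w
    proof (rule cosh_nonzero)
      have "norm w \<le> 1" "1 \<le> sqrt (real N)"
        using that elim by auto
      hence "norm w \<le> sqrt (real N)"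
        by linarith
      thus "norm (w / complex_of_real (sqrt (real N))) \<le> 1"
        using elim by (simp add: norm_divide divide_le_eq)
    qed
    thus ?case
      unfolding f_def cosh_field_def using elim by (intro holomorphic_intros) auto
  qed
  ultimately have "(\<lambda>N. (deriv ^^ m) (f N) 0) \<longlonglongrightarrow> (deriv ^^ m) g 0"
    by (rule higher_deriv_complex_uniform_limit) auto
  also have "(deriv ^^ m) g 0 = hermite m z"
  proof -
    have "(\<lambda>k. hermite k z) = (\<lambda>k. (deriv ^^ k) g 0)"
      by (rule egf_coeffs_unique[of 1])
         (use hermite_sums[of z] in \<open>simp_all add: g_def exp_diff mult.commute\<close>)
    thus ?thesis
      by metis
  qed
  also have "(\<lambda>N. (deriv ^^ m) (f N) 0) \<longlonglongrightarrow> hermite m z \<longleftrightarrow> ?thesis"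
  proof (rule filterlim_cong[OF refl refl])
    show "\<forall>\<^sub>F N in sequentially. (deriv ^^ m) (f N) 0 =
            complex_of_real ((4 / real N) powr (real m / 2)) *
            gen_euler N m (complex_of_real (sqrt (real N) / 2) * z + of_nat N / 2)"
      using eventually_gt_at_top[of 0]
    proof eventually_elim
      case (elim N)
      have "(\<lambda>k. complex_of_real ((4 / real N) powr (real k / 2)) *
              gen_euler N k (complex_of_real (sqrt (real N) / 2) * z + of_nat N / 2))
            = (\<lambda>k. (deriv ^^ k) (f N) 0)"
        unfolding f_def
        by (rule egf_coeffs_unique[of 1], simp, rule rescaled_gen_euler_sums) (use elim in simp_all)
      thus ?case
        by metis
    qed
  qed
  finally show ?thesis .
qed

end
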